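(* Let $R$ be a commutative ring and $M$ a commutative monoid (written additively). Let $\widetilde{M}=\{x\in M: \exists n\geqslant 1,\ \exists y\in M,\ nx+y=y\}$ be the quasi-torsion submonoid of $M$. Then every idempotent of the monoid-ring $R[M]$ is contained in the subring $R[\widetilde{M}]$.
   Context: Rings have an identity. $R[M]$ is the free $R$-module with basis $\{\epsilon_m: m\in M\}$ and multiplication determined $R$-bilinearly by $\epsilon_m\epsilon_n=\epsilon_{m+n}$. $R[\widetilde M]$ is the subring of elements $\sum_m r_m\epsilon_m$ with $r_m=0$ for all $m\notin\widetilde M$. *)

theory Defs
  imports Main "HOL-Library.Poly_Mapping"
begin

text \<open>
  The monoid ring \<open>R[M]\<close> is the type \<open>'m \<Rightarrow>\<^sub>0 'r\<close> of finitely supported functions with the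
  convolution product; the basis element \<open>\<epsilon>\<^sub>m\<close> is \<open>Poly_Mapping.single m e\<close>, where \<open>e\<close> is the
  identity of \<open>R\<close>.  The class \<open>comm_ring_1\<close> excludes the zero ring, so the coefficients are taken
  in \<open>comm_ring\<close> and the existence of an identity is a separate hypothesis.
\<close>

definition has_identity :: "'r::comm_ring itself \<Rightarrow> bool" where
  "has_identity _ \<longleftrightarrow> (\<exists>e::'r. \<forall>r. e * r = r)"

text \<open>The constant sum below is the multiple \<open>n x\<close>.\<close>

definition quasi_torsion :: "'m::comm_monoid_add set" where
  "quasi_torsion = {x. \<exists>n\<ge>1. \<exists>y. (\<Sum>i<(n::nat). x) + y = y}"

definition monoid_ring_on :: "'m::comm_monoid_add set \<Rightarrow> ('m \<Rightarrow>\<^sub>0 'r::comm_ring) set" where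
  "monoid_ring_on S = {f. \<forall>m. m \<notin> S \<longrightarrow> Poly_Mapping.lookup f m = 0}"

lemma zero_in_quasi_torsion: "0 \<in> quasi_torsion"
  unfolding quasi_torsion_def by (auto intro!: exI[of _ "1::nat"])

lemma const_sum_add_absorb:
  fixes z y :: "'m::comm_monoid_add"
  assumes "z + y = y"
  shows "(\<Sum>i<(n::nat). z) + y = y"
proof (induction n)
  case (Suc n)
  then show ?case using assms by (simp add: add.assoc)
qed simp

lemma const_sum_mult:
  "(\<Sum>i<(k * n::nat). x) = (\<Sum>i<k. \<Sum>j<n. (x::'m::comm_monoid_add))"
proof (induction k)
  case (Suc k)
  have "(\<Sum>i<a + b. x) = (\<Sum>i<a. x) + (\<Sum>i<b. x)" for a b :: nat
    by (induction b) (simp_all add: ac_simps)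
  then show ?case using Suc by (simp add: add.commute)
qed simp

lemma add_in_quasi_torsion:
  fixes x x' :: "'m::comm_monoid_add"
  assumes "x \<in> quasi_torsion" and "x' \<in> quasi_torsion"
  shows "x + x' \<in> quasi_torsion"
proof -
  obtain n y n' y' where n: "n \<ge> 1" "(\<Sum>i<(n::nat). x) + y = y"
    and n': "n' \<ge> 1" "(\<Sum>i<(n'::nat). x') + y' = y'"
    using assms unfolding quasi_torsion_def by auto
  have 1: "(\<Sum>i<n' * n. x) + y = y"
    unfolding const_sum_mult by (rule const_sum_add_absorb) (rule n)
  have 2: "(\<Sum>i<n' * n. x') + y' = y'"
    unfolding mult.commute[of n'] const_sum_mult by (rule const_sum_add_absorb) (rule n')
  have "(\<Sum>i<n' * n. x + x') + (y + y')
      = ((\<Sum>i<n' * n. x) + y) + ((\<Sum>i<n' * n. x') + y')"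
    by (simp only: sum.distrib ac_simps)
  also have "\<dots> = y + y'"
    unfolding 1 2 ..
  finally have "(\<Sum>i<n' * n. x + x') + (y + y') = y + y'" .
  moreover have "n' * n \<ge> 1" using n n' by (simp add: Suc_le_eq)
  ultimately show ?thesis unfolding quasi_torsion_def by blast
qed

lemma monoid_ring_on_iff_keys: "f \<in> monoid_ring_on S \<longleftrightarrow> Poly_Mapping.keys f \<subseteq> S"
  unfolding monoid_ring_on_def by (auto simp: in_keys_iff)

lemma monoid_ring_on_closed:
  fixes f g :: "'m::comm_monoid_add \<Rightarrow>\<^sub>0 'r::comm_ring"
  assumes "0 \<in> S" and "\<And>x y. x \<in> S \<Longrightarrow> y \<in> S \<Longrightarrow> x + y \<in> S"
    and "f \<in> monoid_ring_on S" and "g \<in> monoid_ring_on S"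
  shows "Poly_Mapping.single 0 (e::'r) \<in> (monoid_ring_on S :: ('m \<Rightarrow>\<^sub>0 'r) set)"
    and "f - g \<in> monoid_ring_on S" and "f * g \<in> monoid_ring_on S"
  using assms keys_mult[of f g]
  by (auto simp: monoid_ring_on_iff_keys subset_eq in_keys_iff lookup_minus)

end

theory Submission
  imports Defs Complex_Main "HOL-Library.Function_Algebras" "HOL-Library.Multiset"
begin

text \<open>
  If \<open>x\<close> is not quasi-torsion, its image in \<open>G(M) \<otimes> \<rat>\<close> is nonzero, where \<open>G(M)\<close> is the group
  completion of \<open>M\<close>, so a linear functional yields an additive map \<open>\<phi> : M \<Rightarrow> \<rat>\<close> with
  \<open>\<phi> x \<noteq> 0\<close>.  This \<open>\<phi>\<close> grades \<open>R[M]\<close> by an ordered group, and an idempotent of a commutative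
  ring graded by an ordered group is homogeneous of degree \<open>0\<close>; hence \<open>x\<close> is not in its support.
\<close>

section \<open>Idempotents in rings graded by an ordered group\<close>

text \<open>
  The induction is on the number of degrees \<open>i \<noteq> 0\<close> with \<open>z e\<^sub>i \<noteq> 0\<close>.  If \<open>q\<close> is the lowest such
  degree and negative, or else the highest, then \<open>z e\<^sub>q\<^sup>2 = z e\<^bsub>2q\<^esub> = 0\<close>, so the induction hypothesis
  applies to \<open>z e\<^sub>q\<close> and gives \<open>z e\<^sub>q e\<^sub>i = 0\<close> for all \<open>i \<noteq> 0\<close>.  Now \<open>q\<close> drops out for each
  \<open>z e\<^sub>i\<close> as well, so \<open>z e\<^sub>i e\<^sub>j = 0\<close> for all \<open>i, j \<noteq> 0\<close>, and comparing the components of degrees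
  \<open>0\<close> and \<open>r\<close> in \<open>z e\<^sup>2 = z e\<close> finishes.
\<close>

lemma graded_idempotent_annihilates:
  fixes e :: "'g::linordered_ab_group_add \<Rightarrow> 'a::comm_ring" and z :: 'a
  assumes fin: "finite S" and supp: "\<And>i. i \<notin> S \<Longrightarrow> e i = 0"
    and idem: "\<And>k. e k = (\<Sum>i\<in>S. e i * e (k - i))"
    and "r \<noteq> 0"
  shows "z * e r = 0"
  using \<open>r \<noteq> 0\<close>
proof (induction "card {i. i \<noteq> 0 \<and> z * e i \<noteq> 0}" arbitrary: z r rule: less_induct)
  case less
  define D where "D z = {i. i \<noteq> 0 \<and> z * e i \<noteq> 0}" for z
  have IH: "z' * e i = 0" if "D z' \<subset> D z" "i \<noteq> 0" for z' i
  proof -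
    have "D z \<subseteq> S" using supp by (fastforce simp: D_def)
    then have "card (D z') < card (D z)"
      using that fin by (meson finite_subset psubset_card_mono)
    then show ?thesis using less.hyps[of z' i] that by (simp add: D_def)
  qed
  have mono: "D (z * a) \<subseteq> D z" for a
    by (auto simp: D_def) (metis mult.assoc mult.commute mult_zero_left)
  show ?case
  proof (cases "D z = {}")
    case True
    then show ?thesis using less.prems by (auto simp: D_def)
  next
    case False
    have finD: "finite (D z)"
      by (rule finite_subset[OF _ fin]) (use supp in \<open>fastforce simp: D_def\<close>)
    \<comment> \<open>The indices i and 2q - i lie on opposite sides of q, so one is beyond the
      extreme. There z kills e: the sign of q keeps degree 0, which \<open>D\<close> ignores, on the
      other side.\<close>
    obtain q where q: "q \<in> D z" "q + q \<notin> D z"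
      and sep: "\<And>i. i \<noteq> q \<Longrightarrow> z * e i = 0 \<or> z * e (q + q - i) = 0"
    proof (cases "\<exists>i\<in>D z. i < 0")
      case True
      define q where "q = Min (D z)"
      have qD: "q \<in> D z" and le: "\<And>i. i \<in> D z \<Longrightarrow> q \<le> i"
        using finD False by (auto simp: q_def)
      have neg: "q < 0" using True le by force
      have small: "z * e i = 0" if "i < q" for i
        using that neg le[of i] by (force simp: D_def)
      show ?thesis
      proof
        show "q \<in> D z" by fact
        show "q + q \<notin> D z" using neg le by force
        show "z * e i = 0 \<or> z * e (q + q - i) = 0" if "i \<noteq> q" for i
        proof (cases "i < q")
          case False
          then have "q + q - i < q" using that by (simp add: algebra_simps)
          then show ?thesis using small by blast
        qed (use small in blast)
      qed
    next
      case no_neg: False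
      define q where "q = Max (D z)"
      have qD: "q \<in> D z" and le: "\<And>i. i \<in> D z \<Longrightarrow> i \<le> q"
        using finD False by (auto simp: q_def)
      have pos: "q > 0" using no_neg qD by (force simp: D_def)
      have big: "z * e i = 0" if "i > q" for i
        using that pos le[of i] by (force simp: D_def)
      show ?thesis
      proof
        show "q \<in> D z" by fact
        show "q + q \<notin> D z" using pos le by force
        show "z * e i = 0 \<or> z * e (q + q - i) = 0" if "i \<noteq> q" for i
        proof (cases "i > q")
          case False
          then have "q + q - i > q" using that by (simp add: algebra_simps)
          then show ?thesis using big by blast
        qed (use big in blast)
      qed
    qed
    have q0: "q \<noteq> 0" using q by (simp add: D_def)
    have conv: "z * e k = (\<Sum>i\<in>S. z * e i * e (k - i))" for k
      by (subst idem[of k]) (simp add: sum_distrib_left mult.assoc)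
    have "z * e (q + q) = 0"
      using q q0 by (simp add: D_def)
    moreover have "z * e (q + q) = (\<Sum>i\<in>S. if i = q then z * e q * e q else 0)"
      unfolding conv[of "q + q"]
    proof (rule sum.cong[OF refl])
      fix i
      have "z * e i * e (q + q - i) = 0" if "i \<noteq> q"
        using sep[OF that] by (metis mult.assoc mult.commute mult_zero_left)
      then show "z * e i * e (q + q - i) = (if i = q then z * e q * e q else 0)"
        by auto
    qed
    moreover have "q \<in> S" using q supp by (force simp: D_def)
    ultimately have "z * e q * e q = 0"
      using fin by simp
    then have "D (z * e q) \<subset> D z"
      using mono[of "e q"] q by (auto simp: D_def)
    then have zq: "z * e q * e i = 0" if "i \<noteq> 0" for i
      using IH that by blast
    have "D (z * e i) \<subset> D z" if "i \<noteq> 0" for i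
    proof -
      have "z * e i * e q = z * e q * e i" by (simp only: ac_simps)
      then have "q \<notin> D (z * e i)" using zq[OF that] by (simp add: D_def)
      then show ?thesis using mono[of "e i"] q by blast
    qed
    then have zero: "z * e i * e j = 0" if "i \<noteq> 0" "j \<noteq> 0" for i j
      using IH that by blast
    have S0: "(\<Sum>i\<in>S. if i = j then a (e i) else 0) = a (e j)" if "a 0 = 0" for j and a :: "'a \<Rightarrow> 'a"
      using fin supp[of j] that by simp
    have "z * e 0 = (\<Sum>i\<in>S. if i = 0 then z * e i * e 0 else 0)"
      unfolding conv[of 0] by (rule sum.cong) (auto simp: zero)
    then have e0: "z * e 0 * e 0 = z * e 0"
      using S0[of "\<lambda>a. z * a * e 0" 0] by simp
    \<comment> \<open>By \<open>zero\<close>, only the terms with i = 0 or r - i = 0 survive; as r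
      is nonzero, these are different terms.\<close>
    have "z * e r = (\<Sum>i\<in>S. (if i = 0 then z * e i * e r else 0) + (if i = r then z * e i * e 0 else 0))"
      unfolding conv[of r] by (rule sum.cong) (use less.prems in \<open>auto simp: zero\<close>)
    also have "\<dots> = z * e 0 * e r + z * e r * e 0"
      using S0[of "\<lambda>a. z * a * e r" 0] S0[of "\<lambda>a. z * a * e 0" r] by (simp add: sum.distrib)
    finally have er: "z * e r = z * e 0 * e r + z * e 0 * e r"
      by (simp add: ac_simps)
    \<comment> \<open>Write u for \<open>z * e 0 * e r\<close>; then \<open>er\<close> reads
      \<open>z * e r\<close> = u + u. Multiplying by \<open>e 0\<close> and using \<open>e0\<close>
      gives u = u + u, hence u = 0.\<close>
    have "z * e 0 * e r = z * e r * e 0" by (simp add: ac_simps)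
    also have "\<dots> = z * e 0 * e 0 * e r + z * e 0 * e 0 * e r"
      by (subst er) (simp add: distrib_left distrib_right ac_simps)
    finally have "z * e 0 * e r = z * e 0 * e r + z * e 0 * e r"
      unfolding e0 .
    with er show ?thesis by simp
  qed
qed

text \<open>The type \<open>'a\<close> supplies no unit to use as z. Instead, each product
  \<open>e i * e (r - i)\<close> vanishes by taking one factor as z, since i and r - i are not both
  0.\<close>

lemma graded_idempotent_degree_zero:
  fixes e :: "'g::linordered_ab_group_add \<Rightarrow> 'a::comm_ring"
  assumes "finite S" "\<And>i. i \<notin> S \<Longrightarrow> e i = 0"
    and idem: "\<And>k. e k = (\<Sum>i\<in>S. e i * e (k - i))"
    and "r \<noteq> 0"
  shows "e r = 0"
proof -
  note zero = graded_idempotent_annihilates[of S e, OF assms(1-3)]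
  have "e i * e (r - i) = 0" for i
    using zero[of i "e (r - i)"] zero[of "r - i" "e i"] \<open>r \<noteq> 0\<close> by (cases "i = 0") (auto simp: mult.commute)
  then show ?thesis using idem[of r] by simp
qed

section \<open>Homogeneous components in the monoid ring\<close>

definition degree_component :: "('m \<Rightarrow> 'g) \<Rightarrow> 'g \<Rightarrow> ('m \<Rightarrow>\<^sub>0 'r::comm_monoid_add) \<Rightarrow> ('m \<Rightarrow>\<^sub>0 'r)" where
  "degree_component \<phi> q f = (\<Sum>m\<in>{m \<in> Poly_Mapping.keys f. \<phi> m = q}. Poly_Mapping.single m (Poly_Mapping.lookup f m))"

lemma lookup_degree_component:
  "Poly_Mapping.lookup (degree_component \<phi> q f) m = (if \<phi> m = q then Poly_Mapping.lookup f m else 0)"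
proof -
  have "Poly_Mapping.lookup (degree_component \<phi> q f) m
      = (\<Sum>i\<in>{m \<in> Poly_Mapping.keys f. \<phi> m = q}. if i = m then Poly_Mapping.lookup f m else 0)"
    unfolding degree_component_def lookup_sum by (rule sum.cong) (auto simp: lookup_single when_def)
  then show ?thesis by (auto simp: in_keys_iff)
qed

lemma degree_component_sum:
  "degree_component \<phi> q (\<Sum>i\<in>I. f i) = (\<Sum>i\<in>I. degree_component \<phi> q (f i))"
  by (rule poly_mapping_eqI) (simp add: lookup_degree_component lookup_sum)

lemma sum_degree_component:
  assumes "finite S" "\<phi> ` Poly_Mapping.keys f \<subseteq> S"
  shows "(\<Sum>q\<in>S. degree_component \<phi> q f) = f"
proof (rule poly_mapping_eqI)
  fix m
  have "m \<notin> Poly_Mapping.keys f" if "\<phi> m \<notin> S" using assms that by auto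
  then show "Poly_Mapping.lookup (\<Sum>q\<in>S. degree_component \<phi> q f) m = Poly_Mapping.lookup f m"
    using assms by (auto simp: lookup_degree_component lookup_sum in_keys_iff)
qed

text \<open>Additivity of \<phi> puts all keys of the product in degree i + j. The condition i + j =
  k is solved for j so that a sum over j collapses to one term.\<close>

lemma degree_component_mult_homogeneous:
  fixes \<phi> :: "'m::comm_monoid_add \<Rightarrow> 'g::ab_group_add" and f g :: "'m \<Rightarrow>\<^sub>0 'r::comm_ring"
  assumes add: "\<And>a b. \<phi> (a + b) = \<phi> a + \<phi> b"
  shows "degree_component \<phi> k (degree_component \<phi> i f * degree_component \<phi> j g)
    = (if j = k - i then degree_component \<phi> i f * degree_component \<phi> j g else 0)"
proof (rule poly_mapping_eqI)
  fix m
  let ?p = "degree_component \<phi> i f * degree_component \<phi> j g"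
  have "\<phi> m = i + j" if "m \<in> Poly_Mapping.keys ?p"
  proof -
    obtain a b where "m = a + b" "a \<in> Poly_Mapping.keys (degree_component \<phi> i f)" "b \<in> Poly_Mapping.keys (degree_component \<phi> j g)"
      using \<open>m \<in> Poly_Mapping.keys ?p\<close> keys_mult[of "degree_component \<phi> i f" "degree_component \<phi> j g"] by auto
    then show ?thesis using add by (auto simp: in_keys_iff lookup_degree_component split: if_splits)
  qed
  then have "Poly_Mapping.lookup ?p m = 0" if "\<phi> m \<noteq> i + j"
    using that by (meson in_keys_iff)
  then show "Poly_Mapping.lookup (degree_component \<phi> k ?p) m = Poly_Mapping.lookup (if j = k - i then ?p else 0) m"
    by (auto simp: lookup_degree_component algebra_simps)
qed

text \<open>Both factors are expanded into components; for each i only j = k - i contributes, and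
  that component of g is zero if k - i is outside T.\<close>

lemma degree_component_mult:
  fixes \<phi> :: "'m::comm_monoid_add \<Rightarrow> 'g::ab_group_add" and f g :: "'m \<Rightarrow>\<^sub>0 'r::comm_ring"
  assumes add: "\<And>a b. \<phi> (a + b) = \<phi> a + \<phi> b"
    and S: "finite S" "\<phi> ` Poly_Mapping.keys f \<subseteq> S" and T: "finite T" "\<phi> ` Poly_Mapping.keys g \<subseteq> T"
  shows "degree_component \<phi> k (f * g) = (\<Sum>i\<in>S. degree_component \<phi> i f * degree_component \<phi> (k - i) g)"
proof -
  have "f * g = (\<Sum>i\<in>S. \<Sum>j\<in>T. degree_component \<phi> i f * degree_component \<phi> j g)"
    by (subst sum_degree_component[OF S, symmetric], subst sum_degree_component[OF T, symmetric])
      (simp add: sum_product)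
  then have "degree_component \<phi> k (f * g)
      = (\<Sum>i\<in>S. \<Sum>j\<in>T. if j = k - i then degree_component \<phi> i f * degree_component \<phi> j g else 0)"
    by (simp add: degree_component_sum degree_component_mult_homogeneous[OF add])
  also have "\<dots> = (\<Sum>i\<in>S. degree_component \<phi> i f * degree_component \<phi> (k - i) g)"
  proof (rule sum.cong[OF refl])
    fix i
    have "degree_component \<phi> (k - i) g = 0" if "k - i \<notin> T"
      using that T by (intro poly_mapping_eqI) (force simp: lookup_degree_component in_keys_iff)
    then show "(\<Sum>j\<in>T. if j = k - i then degree_component \<phi> i f * degree_component \<phi> j g else 0)
      = degree_component \<phi> i f * degree_component \<phi> (k - i) g"
      using T by (auto simp: sum.delta)
  qed
  finally show ?thesis .
qed

lemma idempotent_keys_degree_zero: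
  fixes \<phi> :: "'m::comm_monoid_add \<Rightarrow> 'g::linordered_ab_group_add" and f :: "'m \<Rightarrow>\<^sub>0 'r::comm_ring"
  assumes "\<And>a b. \<phi> (a + b) = \<phi> a + \<phi> b" and "f * f = f" and "m \<in> Poly_Mapping.keys f"
  shows "\<phi> m = 0"
proof (rule ccontr)
  assume "\<phi> m \<noteq> 0"
  have "degree_component \<phi> (\<phi> m) f = 0"
  proof (rule graded_idempotent_degree_zero)
    show "finite (\<phi> ` Poly_Mapping.keys f)" by simp
    show "degree_component \<phi> i f = 0" if "i \<notin> \<phi> ` Poly_Mapping.keys f" for i
      using that by (intro poly_mapping_eqI) (force simp: lookup_degree_component in_keys_iff)
    show "degree_component \<phi> k f
      = (\<Sum>i\<in>\<phi> ` Poly_Mapping.keys f. degree_component \<phi> i f * degree_component \<phi> (k - i) f)" for k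
      using degree_component_mult[of \<phi> "\<phi> ` Poly_Mapping.keys f" f "\<phi> ` Poly_Mapping.keys f" f k] assms by simp
  qed fact
  then have "Poly_Mapping.lookup (degree_component \<phi> (\<phi> m) f) m = 0" by simp
  with \<open>m \<in> Poly_Mapping.keys f\<close> show False by (simp add: lookup_degree_component in_keys_iff)
qed

section \<open>A rational functional detecting an element that is not quasi-torsion\<close>

definition basis_vector :: "'m \<Rightarrow> 'm \<Rightarrow> rat" where
  "basis_vector a m = of_bool (m = a)"

text \<open>The quotient of \<open>M \<Rightarrow> \<rat>\<close> by the span of these relations contains \<open>G(M) \<otimes> \<rat>\<close>.\<close>

definition additivity_relations :: "('m::comm_monoid_add \<Rightarrow> rat) set" where
  "additivity_relations = {basis_vector (a + b) - basis_vector a - basis_vector b |a b. True}"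

interpretation fun_rat: vector_space "\<lambda>(c::rat) (v::'m \<Rightarrow> rat) m. c * v m"
  by standard (auto simp: fun_eq_iff algebra_simps)

interpretation fun_rat_functional: vector_space_pair "\<lambda>(c::rat) (v::'m \<Rightarrow> rat) m. c * v m" "(*) :: rat \<Rightarrow> rat \<Rightarrow> rat"
  by standard (auto simp: fun_eq_iff algebra_simps)

lemma sum_mset_replicate_add:
  "\<Sum>\<^sub># (replicate_mset n (a + b)) = \<Sum>\<^sub># (replicate_mset n a) + \<Sum>\<^sub># (replicate_mset n (b::'m::comm_monoid_add))"
  by (induction n) (auto simp: ac_simps)

text \<open>Exchanging one copy of A for one of B gives y back, so the same y serves all n
  copies.\<close>

lemma sum_mset_repeat_absorb:
  fixes A B :: "'m::comm_monoid_add multiset"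
  assumes "\<Sum>\<^sub># A + y = \<Sum>\<^sub># B + y"
  shows "\<Sum>\<^sub># (repeat_mset n A) + y = \<Sum>\<^sub># (repeat_mset n B) + y"
proof (induction n)
  case (Suc n)
  have "\<Sum>\<^sub># (repeat_mset (Suc n) A) + y = \<Sum>\<^sub># A + (\<Sum>\<^sub># (repeat_mset n A) + y)"
    by (simp add: ac_simps)
  also have "\<dots> = \<Sum>\<^sub># (repeat_mset n B) + (\<Sum>\<^sub># A + y)"
    unfolding Suc by (simp add: ac_simps)
  also have "\<dots> = \<Sum>\<^sub># (repeat_mset (Suc n) B) + y"
    unfolding assms by (simp add: ac_simps)
  finally show ?case .
qed simp

text \<open>The factor n clears denominators, and terms of positive and negative sign go to A and B,
  which may overlap. A relation trades a + b for the pair a, b, which leaves sums in M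
  unchanged.\<close>

lemma span_additivity_relations:
  fixes v :: "'m::comm_monoid_add \<Rightarrow> rat"
  assumes "v \<in> fun_rat.span additivity_relations"
  shows "\<exists>n A B y. n > 0 \<and> (\<forall>m. of_nat n * v m = of_nat (count A m) - of_nat (count B m))
    \<and> \<Sum>\<^sub># A + y = \<Sum>\<^sub># B + y"
  using assms
proof (induction rule: fun_rat.span_induct_alt)
  case base
  show ?case
    by (rule exI[of _ 1], rule exI[of _ "{#}"], rule exI[of _ "{#}"]) simp
next
  case (step c x v)
  obtain a b where x: "x = basis_vector (a + b) - basis_vector a - basis_vector b"
    using step.hyps by (auto simp: additivity_relations_def)
  obtain n A B y where n: "n > 0" and v: "\<And>m. of_nat n * v m = of_nat (count A m) - of_nat (count B m)"
    and AB: "\<Sum>\<^sub># A + y = \<Sum>\<^sub># B + y"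
    using step.IH by blast
  \<comment> \<open>Multiplicities cannot be negative, so the numerator of c is split into positive
    part s and negative part t.\<close>
  obtain s t q :: nat where q: "q > 0" and c: "of_nat q * c = of_nat s - of_nat t"
  proof -
    obtain k l where kl: "c = of_int k / of_int l" "l > 0"
      by (metis Fract_of_int_quotient Rat_cases)
    show ?thesis
    proof (rule that[of "nat l" "nat k" "nat (- k)"])
      show "of_nat (nat l) * c = of_nat (nat k) - of_nat (nat (- k))"
        using kl by (cases "k \<ge> 0") auto
    qed (use kl in auto)
  qed
  \<comment> \<open>These collect the positive and the negative terms of n(s - t)x. Both sum in M to
    the multiple n(s + t) of a + b.\<close>
  define A\<^sub>0 where "A\<^sub>0 = replicate_mset (n * s) (a + b) + replicate_mset (n * t) a + replicate_mset (n * t) b"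
  define B\<^sub>0 where "B\<^sub>0 = replicate_mset (n * t) (a + b) + replicate_mset (n * s) a + replicate_mset (n * s) b"
  let ?A = "A\<^sub>0 + repeat_mset q A" and ?B = "B\<^sub>0 + repeat_mset q B"
  show ?case
  proof (rule exI[of _ "n * q"], rule exI[of _ ?A], rule exI[of _ ?B], rule exI[of _ y], intro conjI allI)
    show "n * q > 0" using n q by simp
    fix m :: 'm
    have replicate: "(of_nat (count (replicate_mset k z) m) :: rat) = of_nat k * basis_vector z m" for k z
      by (simp add: basis_vector_def)
    have "of_nat (n * q) * ((\<lambda>m. c * x m) + v) m
        = of_nat n * (of_nat q * c) * x m + of_nat q * (of_nat n * v m)"
      unfolding plus_fun_apply of_nat_mult by algebra
    also have "\<dots> = of_nat (count ?A m) - of_nat (count ?B m)"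
    proof -
      have xm: "x m = basis_vector (a + b) m - basis_vector a m - basis_vector b m"
        by (simp add: x)
      show ?thesis
        unfolding c v A\<^sub>0_def B\<^sub>0_def xm count_union of_nat_add replicate count_repeat_mset of_nat_mult
        by algebra
    qed
    finally show "of_nat (n * q) * ((\<lambda>m. c * x m) + v) m = of_nat (count ?A m) - of_nat (count ?B m)" .
  next
    have "\<Sum>\<^sub># A\<^sub>0 = \<Sum>\<^sub># B\<^sub>0"
      by (simp add: A\<^sub>0_def B\<^sub>0_def sum_mset_replicate_add ac_simps)
    then show "\<Sum>\<^sub># ?A + y = \<Sum>\<^sub># ?B + y"
      using sum_mset_repeat_absorb[OF AB, of q] by (simp add: add.assoc)
  qed
qed

text \<open>The counts show that A is B together with n copies of x. Hence adding n x fixes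
  \<open>\<Sum>\<^sub># B + y\<close>, which is the required witness.\<close>

lemma quasi_torsion_if_in_span:
  fixes x :: "'m::comm_monoid_add"
  assumes "basis_vector x \<in> fun_rat.span additivity_relations"
  shows "x \<in> quasi_torsion"
proof -
  obtain n A B y where n: "n > 0"
    and cnt: "\<And>m. of_nat n * basis_vector x m = of_nat (count A m) - of_nat (count B m)"
    and AB: "\<Sum>\<^sub># A + y = \<Sum>\<^sub># B + y"
    using span_additivity_relations[OF assms] by blast
  have "A = replicate_mset n x + B"
  proof (rule multiset_eqI)
    fix m
    have "(of_nat (count A m) :: rat) = of_nat (count (replicate_mset n x + B) m)"
      using cnt[of m] by (auto simp: basis_vector_def split: if_splits)
    then show "count A m = count (replicate_mset n x + B) m"
      by (simp only: of_nat_eq_iff)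
  qed
  moreover have "\<Sum>\<^sub># (replicate_mset n x) = (\<Sum>i<n. x)"
    by (induction n) (auto simp: ac_simps)
  ultimately have "(\<Sum>i<n. x) + (\<Sum>\<^sub># B + y) = \<Sum>\<^sub># B + y"
    using AB by (simp add: ac_simps)
  then show ?thesis
    using n unfolding quasi_torsion_def by (auto simp: Suc_le_eq)
qed

text \<open>Let B be a basis of the span of the relations. The vector of x is independent of B, so
  some linear functional is 1 on it and 0 on B; vanishing on the relations is the additivity of
  \<phi>.\<close>

lemma not_quasi_torsion_additive_functional:
  fixes x :: "'m::comm_monoid_add"
  assumes "x \<notin> quasi_torsion"
  obtains \<phi> :: "'m \<Rightarrow> rat" where "\<And>a b. \<phi> (a + b) = \<phi> a + \<phi> b" and "\<phi> x \<noteq> 0"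
proof -
  let ?L = "additivity_relations :: ('m \<Rightarrow> rat) set"
  obtain B where B: "B \<subseteq> ?L" "fun_rat.independent B" "?L \<subseteq> fun_rat.span B"
    by (rule fun_rat.maximal_independent_subset)
  have notin: "basis_vector x \<notin> fun_rat.span B"
    using quasi_torsion_if_in_span[of x] assms fun_rat.span_mono[OF B(1)] by blast
  then have "fun_rat.independent (insert (basis_vector x) B)"
    using B(2) by (simp add: fun_rat.independent_insertI)
  then obtain \<Phi> where lin: "Vector_Spaces.linear (\<lambda>c v m. c * v m) (*) \<Phi>"
    and val: "\<And>v. v \<in> insert (basis_vector x) B \<Longrightarrow> \<Phi> v = of_bool (v = basis_vector x)"
    using fun_rat_functional.linear_independent_extend[of "insert (basis_vector x) B" "\<lambda>v. of_bool (v = basis_vector x)"]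
    by blast
  have "\<Phi> v = 0" if "v \<in> B" for v
    using val[of v] that notin fun_rat.span_base by auto
  then have van: "\<Phi> v = 0" if "v \<in> ?L" for v
    using fun_rat_functional.linear_eq_0_on_span[OF lin, of B v] that B(3) by blast
  show ?thesis
  proof (rule that[of "\<lambda>a. \<Phi> (basis_vector a)"])
    fix a b :: 'm
    have "\<Phi> (basis_vector (a + b) - basis_vector a - basis_vector b) = 0"
      by (rule van) (auto simp: additivity_relations_def)
    then show "\<Phi> (basis_vector (a + b)) = \<Phi> (basis_vector a) + \<Phi> (basis_vector b)"
      by (simp add: fun_rat_functional.linear_diff[OF lin])
    show "\<Phi> (basis_vector x) \<noteq> 0" using val by simp
  qed
qed

theorem corollary6p8:
  fixes f :: "'m::comm_monoid_add \<Rightarrow>\<^sub>0 'r::comm_ring"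
  assumes "has_identity TYPE('r)"
    and "f * f = f"
  shows "f \<in> monoid_ring_on quasi_torsion"
  unfolding monoid_ring_on_iff_keys
proof
  fix x assume x: "x \<in> Poly_Mapping.keys f"
  show "x \<in> quasi_torsion"
  proof (rule ccontr)
    assume "x \<notin> quasi_torsion"
    then obtain \<phi> :: "'m \<Rightarrow> rat" where "\<And>a b. \<phi> (a + b) = \<phi> a + \<phi> b" and "\<phi> x \<noteq> 0"
      by (rule not_quasi_torsion_additive_functional) blast
    then show False using idempotent_keys_degree_zero[of \<phi> f x] assms(2) x by blast
  qed
qed

end
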